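(* Let $X$ be a finite set, let $\sigma:X\times X\to X\times X$ be a birack with derived rack operation $\triangleleft$, and let $\sim$ be the equivalence relation on $X$ generated by $x\sim x\triangleleft x$ for $x\in X$. Then $G_X=G_{X/\sim}$; that is, the canonical projection $X\to X/\!\sim$ induces an isomorphism of enveloping groups $G_X\to G_{X/\sim}$.
   Context: A birack on $X$ is a bijective map $\sigma:X\times X\to X\times X$, $\sigma(x,y)=(g_x(y),f_y(x))$, satisfying the braid equation $(\sigma\times \mathrm{Id})(\mathrm{Id}\times\sigma)(\sigma\times \mathrm{Id})=(\mathrm{Id}\times\sigma)(\sigma\times \mathrm{Id})(\mathrm{Id}\times\sigma)$, such that all $g_x:X\to X$ and all $f_y:X\to X$ are bijective. Its derived rack operation is $x\triangleleft y:=g_y(f_{g_x^{-1}(y)}(x))$. For a set $Y$ with a map $\tau:Y\times Y\to Y\times Y$, the enveloping group is $$G_Y:=\mathrm{Free}(Y)/\langle xy=zt:\ x,y\in Y,\ \tau(x,y)=(z,t)\rangle.$$ $G_X$ is formed with $\sigma$, and $G_{X/\sim}$ is formed with the map $\overline{\sigma}$ on $X/\!\sim$ induced by $\sigma$, namely $\overline{\sigma}([x],[y])=([g_x(y)],[f_y(x)])$ (which is well defined). *)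

theory Defs
  imports "HOL-Algebra.Coset"
begin

subsection \<open>Generated equivalence relations\<close>

definition gen_equiv :: "'a set \<Rightarrow> 'a rel \<Rightarrow> 'a rel" where
  "gen_equiv A S = A \<times> A \<inter> \<Inter>{R. equiv A R \<and> S \<subseteq> R}"

lemma equiv_gen_equiv: "equiv A (gen_equiv A S)"
proof (rule equivI)
  show "gen_equiv A S \<subseteq> A \<times> A" by (auto simp: gen_equiv_def)
  show "refl_on A (gen_equiv A S)"
    by (auto simp: gen_equiv_def refl_on_def equiv_def)
  show "sym (gen_equiv A S)"
    by (auto simp: gen_equiv_def equiv_def intro!: symI dest: symD)
  show "trans (gen_equiv A S)"
    unfolding gen_equiv_def equiv_def by (intro transI) (auto dest: transD)
qed

lemma gen_equiv_superset: "S \<subseteq> A \<times> A \<Longrightarrow> S \<subseteq> gen_equiv A S"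
  by (auto simp: gen_equiv_def)

lemma gen_equiv_least: "equiv A R \<Longrightarrow> S \<subseteq> R \<Longrightarrow> gen_equiv A S \<subseteq> R"
  by (auto simp: gen_equiv_def)


subsection \<open>Biracks\<close>

text \<open>A map \<open>\<sigma>\<close> on \<open>X \<times> X\<close> has components \<open>\<sigma> (x, y) = (g\<^sub>x y, f\<^sub>y x)\<close>.
  In \<open>lower_map \<sigma> y\<close>, that is \<open>f\<^sub>y\<close>, the parameter comes first.\<close>

definition upper_map :: "('a \<times> 'a \<Rightarrow> 'a \<times> 'a) \<Rightarrow> 'a \<Rightarrow> 'a \<Rightarrow> 'a" where
  "upper_map \<sigma> x y = fst (\<sigma> (x, y))"

definition lower_map :: "('a \<times> 'a \<Rightarrow> 'a \<times> 'a) \<Rightarrow> 'a \<Rightarrow> 'a \<Rightarrow> 'a" where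
  "lower_map \<sigma> y x = snd (\<sigma> (x, y))"

definition on_12 :: "('a \<times> 'a \<Rightarrow> 'a \<times> 'a) \<Rightarrow> 'a \<times> 'a \<times> 'a \<Rightarrow> 'a \<times> 'a \<times> 'a" where
  "on_12 \<sigma> = (\<lambda>(x, y, z). (fst (\<sigma> (x, y)), snd (\<sigma> (x, y)), z))"

definition on_23 :: "('a \<times> 'a \<Rightarrow> 'a \<times> 'a) \<Rightarrow> 'a \<times> 'a \<times> 'a \<Rightarrow> 'a \<times> 'a \<times> 'a" where
  "on_23 \<sigma> = (\<lambda>(x, y, z). (x, fst (\<sigma> (y, z)), snd (\<sigma> (y, z))))"

definition birack :: "'a set \<Rightarrow> ('a \<times> 'a \<Rightarrow> 'a \<times> 'a) \<Rightarrow> bool" where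
  "birack X \<sigma> \<longleftrightarrow>
     bij_betw \<sigma> (X \<times> X) (X \<times> X) \<and>
     (\<forall>w \<in> X \<times> X \<times> X. on_12 \<sigma> (on_23 \<sigma> (on_12 \<sigma> w)) = on_23 \<sigma> (on_12 \<sigma> (on_23 \<sigma> w))) \<and>
     (\<forall>x \<in> X. bij_betw (upper_map \<sigma> x) X X) \<and>
     (\<forall>y \<in> X. bij_betw (lower_map \<sigma> y) X X)"

definition derived_rack :: "'a set \<Rightarrow> ('a \<times> 'a \<Rightarrow> 'a \<times> 'a) \<Rightarrow> 'a \<Rightarrow> 'a \<Rightarrow> 'a" where
  "derived_rack X \<sigma> x y =
     upper_map \<sigma> y (lower_map \<sigma> (inv_into X (upper_map \<sigma> x) y) x)"

definition square_equiv :: "'a set \<Rightarrow> ('a \<times> 'a \<Rightarrow> 'a \<times> 'a) \<Rightarrow> 'a rel" where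
  "square_equiv X \<sigma> = gen_equiv X {(x, derived_rack X \<sigma> x x) | x. x \<in> X}"

text \<open>The map induced on pairs of classes: the common value of
  \<open>([g\<^sub>x y], [f\<^sub>y x])\<close> over all representatives \<open>x \<in> A\<close>, \<open>y \<in> B\<close>.
  It is independent of the representatives when \<open>\<sigma>\<close> is a birack and \<open>R\<close> is
  \<open>square_equiv X \<sigma>\<close>; in general it is unspecified.\<close>

definition induced_map ::
  "'a rel \<Rightarrow> ('a \<times> 'a \<Rightarrow> 'a \<times> 'a) \<Rightarrow> 'a set \<times> 'a set \<Rightarrow> 'a set \<times> 'a set" where
  "induced_map R \<sigma> = (\<lambda>(A, B).
     the_elem ((\<lambda>(x, y). (R `` {upper_map \<sigma> x y}, R `` {lower_map \<sigma> y x})) ` (A \<times> B)))"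


subsection \<open>Free groups\<close>

text \<open>Words are lists of letters; \<open>(x, True)\<close> stands for the generator \<open>x\<close> and
  \<open>(x, False)\<close> for its formal inverse.  Elements of the free group are classes of words
  modulo insertion and deletion of adjacent mutually inverse letters.\<close>

definition free_words :: "'a set \<Rightarrow> ('a \<times> bool) list set" where
  "free_words Y = lists (Y \<times> UNIV)"

definition free_cancel :: "'a set \<Rightarrow> ('a \<times> bool) list rel" where
  "free_cancel Y = {(u @ [(x, b), (x, \<not> b)] @ v, u @ v) | u v x b.
     u \<in> free_words Y \<and> v \<in> free_words Y \<and> x \<in> Y}"

definition free_rel :: "'a set \<Rightarrow> ('a \<times> bool) list rel" where
  "free_rel Y = gen_equiv (free_words Y) (free_cancel Y)"

definition free_group :: "'a set \<Rightarrow> ('a \<times> bool) list set monoid" where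
  "free_group Y =
     \<lparr>carrier = free_words Y // free_rel Y,
      mult = (\<lambda>A B. \<Union>a\<in>A. \<Union>b\<in>B. free_rel Y `` {a @ b}),
      one = free_rel Y `` {[]}\<rparr>"

definition free_gen :: "'a set \<Rightarrow> 'a \<Rightarrow> ('a \<times> bool) list set" where
  "free_gen Y x = free_rel Y `` {[(x, True)]}"

lemma equiv_free_rel: "equiv (free_words Y) (free_rel Y)"
  by (simp add: free_rel_def equiv_gen_equiv)

lemma free_cancel_in_rel: "free_cancel Y \<subseteq> free_rel Y"
  unfolding free_rel_def
  by (rule gen_equiv_superset) (auto simp: free_cancel_def free_words_def)

lemma free_words_append:
  "u \<in> free_words Y \<Longrightarrow> v \<in> free_words Y \<Longrightarrow> u @ v \<in> free_words Y"
  by (simp add: free_words_def)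

lemma free_rel_context:
  assumes "(a, b) \<in> free_rel Y" "u \<in> free_words Y" "v \<in> free_words Y"
  shows "(u @ a @ v, u @ b @ v) \<in> free_rel Y"
proof -
  let ?R = "{(a, b) \<in> free_words Y \<times> free_words Y. (u @ a @ v, u @ b @ v) \<in> free_rel Y}"
  have "equiv (free_words Y) ?R"
    using equiv_free_rel[of Y] assms(2,3)
    unfolding equiv_def
    by (auto simp: refl_on_def sym_def free_words_append intro!: transI dest: transD)
  moreover have "free_cancel Y \<subseteq> ?R"
  proof
    fix p assume "p \<in> free_cancel Y"
    then obtain s t x c where p: "p = (s @ [(x, c), (x, \<not> c)] @ t, s @ t)"
      "s \<in> free_words Y" "t \<in> free_words Y" "x \<in> Y"
      by (auto simp: free_cancel_def)
    have "((u @ s) @ [(x, c), (x, \<not> c)] @ (t @ v), (u @ s) @ (t @ v)) \<in> free_cancel Y"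
      unfolding free_cancel_def using p assms(2,3) free_words_append by blast
    with free_cancel_in_rel[of Y] p show "p \<in> ?R"
      by (auto simp: free_words_def)
  qed
  ultimately have "free_rel Y \<subseteq> ?R"
    unfolding free_rel_def by (rule gen_equiv_least)
  with assms(1) show ?thesis by auto
qed

lemma free_rel_append_congruent:
  "congruent2 (free_rel Y) (free_rel Y) (\<lambda>a b. free_rel Y `` {a @ b})"
proof (rule congruent2I[OF equiv_free_rel equiv_free_rel])
  fix a a' b assume "(a, a') \<in> free_rel Y" "b \<in> free_words Y"
  then show "free_rel Y `` {a @ b} = free_rel Y `` {a' @ b}"
    using free_rel_context[of a a' Y "[]" b] equiv_class_eq[OF equiv_free_rel]
    by (auto simp: free_words_def)
next
  fix a a' b assume "(a, a') \<in> free_rel Y" "b \<in> free_words Y"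
  then show "free_rel Y `` {b @ a} = free_rel Y `` {b @ a'}"
    using free_rel_context[of a a' Y b "[]"] equiv_class_eq[OF equiv_free_rel]
    by (auto simp: free_words_def)
qed

lemma free_group_mult:
  assumes "a \<in> free_words Y" "b \<in> free_words Y"
  shows "free_rel Y `` {a} \<otimes>\<^bsub>free_group Y\<^esub> free_rel Y `` {b} = free_rel Y `` {a @ b}"
  using UN_equiv_class2[OF equiv_free_rel equiv_free_rel free_rel_append_congruent assms]
  by (simp add: free_group_def)

lemma free_rel_inverse:
  assumes "a \<in> free_words Y"
  shows "(map (\<lambda>(x, b). (x, \<not> b)) (rev a) @ a, []) \<in> free_rel Y"
  using assms
proof (induction a)
  case Nil
  then show ?case
    using equiv_free_rel[of Y] by (auto simp: equiv_def refl_on_def free_words_def)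
next
  case (Cons l a)
  obtain x b where l: "l = (x, b)" by (cases l)
  let ?i = "map (\<lambda>(x, b). (x, \<not> b)) (rev a)"
  have i: "?i \<in> free_words Y" and a: "a \<in> free_words Y" and x: "x \<in> Y"
    using Cons.prems l by (auto simp: free_words_def)
  have "(?i @ [(x, \<not> b), (x, \<not> \<not> b)] @ a, ?i @ a) \<in> free_cancel Y"
    unfolding free_cancel_def using i a x by blast
  then have "(?i @ [(x, \<not> b), (x, b)] @ a, ?i @ a) \<in> free_rel Y"
    using free_cancel_in_rel[of Y] by auto
  moreover have "(?i @ a, []) \<in> free_rel Y" using Cons.IH a by simp
  ultimately show ?case
    using equiv_free_rel[of Y] l by (auto simp: equiv_def dest: transD)
qed

lemma group_free_group: "group (free_group Y)"
proof (rule groupI)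
  let ?C = "\<lambda>a. free_rel Y `` {a}"
  have car: "A \<in> carrier (free_group Y) \<longleftrightarrow> (\<exists>a \<in> free_words Y. A = ?C a)" for A
    by (auto simp: free_group_def quotient_def)
  have one: "\<one>\<^bsub>free_group Y\<^esub> = ?C []" by (simp add: free_group_def)
  have nil: "[] \<in> free_words Y" by (simp add: free_words_def)
  show "\<one>\<^bsub>free_group Y\<^esub> \<in> carrier (free_group Y)"
    using car one nil by blast
  fix A assume "A \<in> carrier (free_group Y)"
  then obtain a where a: "a \<in> free_words Y" "A = ?C a" using car by blast
  show "\<one>\<^bsub>free_group Y\<^esub> \<otimes>\<^bsub>free_group Y\<^esub> A = A"
    using a nil by (simp add: one free_group_mult)
  let ?i = "map (\<lambda>(x, b). (x, \<not> b)) (rev a)"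
  have i: "?i \<in> free_words Y" using a by (auto simp: free_words_def)
  have "?C ?i \<otimes>\<^bsub>free_group Y\<^esub> A = \<one>\<^bsub>free_group Y\<^esub>"
    using equiv_class_eq[OF equiv_free_rel free_rel_inverse[OF a(1)]]
    by (simp add: a(2) one free_group_mult[OF i a(1)])
  then show "\<exists>B \<in> carrier (free_group Y). B \<otimes>\<^bsub>free_group Y\<^esub> A = \<one>\<^bsub>free_group Y\<^esub>"
    using car i by blast
  fix B assume "B \<in> carrier (free_group Y)"
  then obtain b where b: "b \<in> free_words Y" "B = ?C b" using car by blast
  show "A \<otimes>\<^bsub>free_group Y\<^esub> B \<in> carrier (free_group Y)"
    using a b car free_group_mult free_words_append by metis
  fix D assume "D \<in> carrier (free_group Y)"
  then obtain d where d: "d \<in> free_words Y" "D = ?C d" using car by blast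
  show "A \<otimes>\<^bsub>free_group Y\<^esub> B \<otimes>\<^bsub>free_group Y\<^esub> D
      = A \<otimes>\<^bsub>free_group Y\<^esub> (B \<otimes>\<^bsub>free_group Y\<^esub> D)"
    using a b d by (simp add: free_group_mult free_words_append)
qed


subsection \<open>Enveloping groups\<close>

definition normal_closure :: "('g, 'm) monoid_scheme \<Rightarrow> 'g set \<Rightarrow> 'g set" where
  "normal_closure G S = \<Inter>{N. N \<lhd> G \<and> S \<subseteq> N}"

lemma normal_normal_closure:
  assumes "group G" "S \<subseteq> carrier G"
  shows "normal_closure G S \<lhd> G"
proof -
  interpret group G by fact
  let ?N = "{N. N \<lhd> G \<and> S \<subseteq> N}"
  have "carrier G \<in> ?N"
    using assms(2) by (auto simp: normal_inv_iff subgroup_self)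
  then have "subgroup (\<Inter>?N) G"
    by (intro subgroups_Inter) (auto simp: normal_imp_subgroup)
  then show ?thesis
    unfolding normal_closure_def by (subst normal_inv_iff) (auto simp: normal_inv_iff)
qed

definition enveloping_relators ::
  "'a set \<Rightarrow> ('a \<times> 'a \<Rightarrow> 'a \<times> 'a) \<Rightarrow> ('a \<times> bool) list set set" where
  "enveloping_relators Y \<tau> =
     {free_gen Y x \<otimes>\<^bsub>free_group Y\<^esub> free_gen Y y
        \<otimes>\<^bsub>free_group Y\<^esub> inv\<^bsub>free_group Y\<^esub> (free_gen Y z \<otimes>\<^bsub>free_group Y\<^esub> free_gen Y t)
      | x y z t. x \<in> Y \<and> y \<in> Y \<and> \<tau> (x, y) = (z, t)}"

definition enveloping_kernel ::
  "'a set \<Rightarrow> ('a \<times> 'a \<Rightarrow> 'a \<times> 'a) \<Rightarrow> ('a \<times> bool) list set set" where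
  "enveloping_kernel Y \<tau> = normal_closure (free_group Y) (enveloping_relators Y \<tau>)"

definition enveloping_group ::
  "'a set \<Rightarrow> ('a \<times> 'a \<Rightarrow> 'a \<times> 'a) \<Rightarrow> ('a \<times> bool) list set set monoid" where
  "enveloping_group Y \<tau> = free_group Y Mod enveloping_kernel Y \<tau>"

definition enveloping_gen ::
  "'a set \<Rightarrow> ('a \<times> 'a \<Rightarrow> 'a \<times> 'a) \<Rightarrow> 'a \<Rightarrow> ('a \<times> bool) list set set" where
  "enveloping_gen Y \<tau> x = enveloping_kernel Y \<tau> #>\<^bsub>free_group Y\<^esub> free_gen Y x"

lemma free_gen_closed: "x \<in> Y \<Longrightarrow> free_gen Y x \<in> carrier (free_group Y)"
  by (auto simp: free_gen_def free_group_def free_words_def intro!: quotientI)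

lemma group_enveloping_group:
  assumes "\<tau> ` (Y \<times> Y) \<subseteq> Y \<times> Y"
  shows "group (enveloping_group Y \<tau>)"
proof -
  interpret group "free_group Y" by (rule group_free_group)
  have "enveloping_relators Y \<tau> \<subseteq> carrier (free_group Y)"
  proof
    fix r assume "r \<in> enveloping_relators Y \<tau>"
    then obtain x y z t where r: "x \<in> Y" "y \<in> Y" "\<tau> (x, y) = (z, t)"
      "r = free_gen Y x \<otimes>\<^bsub>free_group Y\<^esub> free_gen Y y
         \<otimes>\<^bsub>free_group Y\<^esub> inv\<^bsub>free_group Y\<^esub> (free_gen Y z \<otimes>\<^bsub>free_group Y\<^esub> free_gen Y t)"
      unfolding enveloping_relators_def by blast
    have "\<tau> (x, y) \<in> Y \<times> Y" using assms r(1,2) by blast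
    then have "z \<in> Y" "t \<in> Y" using r(3) by simp_all
    then show "r \<in> carrier (free_group Y)"
      unfolding r(4) using r(1,2) by (intro m_closed inv_closed free_gen_closed)
  qed
  then have "enveloping_kernel Y \<tau> \<lhd> free_group Y"
    unfolding enveloping_kernel_def by (rule normal_normal_closure[OF group_free_group])
  then show ?thesis
    unfolding enveloping_group_def by (rule normal.factorgroup_is_group)
qed

end

theory Submission
  imports Defs
begin

text \<open>
  Choose \<open>z\<close> with \<open>g\<^sub>x z = x\<close> and put \<open>w = f\<^sub>z x\<close>, so \<open>\<sigma> (x, z) = (x, w)\<close>.  Cancelling \<open>g\<^sub>x\<close>
  and \<open>f\<^sub>x\<close> in the braid equation shows that \<open>z\<close> and \<open>w\<close> act in the same way, whence
  \<open>\<sigma> (x, w) = (x \<triangleleft> x, w)\<close>.  Cancelling \<open>w\<close>, the generators \<open>x\<close> and \<open>x \<triangleleft> x\<close> agree in \<open>G\<^sub>X\<close>,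
  and the elements \<open>x\<close> and \<open>x \<triangleleft> x\<close> act in the same way on \<open>X\<close>.  The actions commute with
  \<open>x \<mapsto> x \<triangleleft> x\<close>, so the class map and a choice of representatives respect the defining relations
  and induce mutually inverse homomorphisms.
\<close>

subsection \<open>Squares in a birack\<close>

text \<open>The pairs of points of \<open>X\<close> satisfying \<open>P\<close> form an equivalence
  relation on \<open>X\<close> containing the generating pairs, so they contain the least such
  relation. The square case also asks for membership in \<open>X\<close> because the relation must
  live on \<open>X\<close>.\<close>

lemma square_equiv_induct [consumes 1, case_names refl sym trans square]:
  assumes "(a, b) \<in> square_equiv X \<sigma>"
    and "\<And>x. x \<in> X \<Longrightarrow> P x x"
    and "\<And>x y. x \<in> X \<Longrightarrow> y \<in> X \<Longrightarrow> P x y \<Longrightarrow> P y x"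
    and "\<And>x y z. x \<in> X \<Longrightarrow> y \<in> X \<Longrightarrow> z \<in> X \<Longrightarrow> P x y \<Longrightarrow> P y z \<Longrightarrow> P x z"
    and "\<And>x. x \<in> X \<Longrightarrow> derived_rack X \<sigma> x x \<in> X \<and> P x (derived_rack X \<sigma> x x)"
  shows "P a b"
proof -
  let ?R = "{(x, y). x \<in> X \<and> y \<in> X \<and> P x y}"
  have "equiv X ?R"
    using assms(2,3,4) by (intro equivI refl_onI symI transI) blast+
  then have "square_equiv X \<sigma> \<subseteq> ?R"
    unfolding square_equiv_def using assms(5) by (intro gen_equiv_least) auto
  with assms(1) show ?thesis by auto
qed

lemma equiv_square_equiv: "equiv X (square_equiv X \<sigma>)"
  by (simp add: square_equiv_def equiv_gen_equiv)

lemma square_equiv_class_eq_iff: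
  "x \<in> X \<Longrightarrow> y \<in> X \<Longrightarrow>
    square_equiv X \<sigma> `` {x} = square_equiv X \<sigma> `` {y} \<longleftrightarrow> (x, y) \<in> square_equiv X \<sigma>"
  by (rule eq_equiv_class_iff[OF equiv_square_equiv])

section \<open>Component maps and the braid equation\<close>

context
  fixes X :: "'a set" and \<sigma> :: "'a \<times> 'a \<Rightarrow> 'a \<times> 'a"
  assumes birack: "birack X \<sigma>"
begin

private abbreviation (input) g where "g \<equiv> upper_map \<sigma>"
private abbreviation (input) f where "f \<equiv> lower_map \<sigma>"
private abbreviation (input) sq where "sq x \<equiv> derived_rack X \<sigma> x x"

lemma birack_eq: "\<sigma> (x, y) = (g x y, f y x)"
  by (simp add: upper_map_def lower_map_def)

lemma bij_upper: "x \<in> X \<Longrightarrow> bij_betw (g x) X X"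
  and bij_lower: "x \<in> X \<Longrightarrow> bij_betw (f x) X X"
  using birack by (auto simp: birack_def)

lemma upper_closed [simp]: "x \<in> X \<Longrightarrow> y \<in> X \<Longrightarrow> g x y \<in> X"
  using bij_betw_apply[OF bij_upper] .

lemma lower_closed [simp]: "x \<in> X \<Longrightarrow> y \<in> X \<Longrightarrow> f x y \<in> X"
  using bij_betw_apply[OF bij_lower] .

lemma upper_cancel:
  assumes "x \<in> X" "u \<in> X" "v \<in> X" "g x u = g x v" shows "u = v"
  using inj_onD[OF bij_betw_imp_inj_on[OF bij_upper[OF assms(1)]] assms(4,2,3)] .

lemma lower_cancel:
  assumes "x \<in> X" "u \<in> X" "v \<in> X" "f x u = f x v" shows "u = v"
  using inj_onD[OF bij_betw_imp_inj_on[OF bij_lower[OF assms(1)]] assms(4,2,3)] .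

lemma upper_surjE:
  assumes "x \<in> X" "u \<in> X" obtains v where "v \<in> X" "g x v = u"
proof -
  have "u \<in> g x ` X" using assms bij_betw_imp_surj_on[OF bij_upper] by simp
  then show thesis by (elim imageE) (rule that, simp_all)
qed

lemma lower_surjE:
  assumes "x \<in> X" "u \<in> X" obtains v where "v \<in> X" "f x v = u"
proof -
  have "u \<in> f x ` X" using assms bij_betw_imp_surj_on[OF bij_lower] by simp
  then show thesis by (elim imageE) (rule that, simp_all)
qed

text \<open>Both sides of the braid equation at \<open>(x, y, z)\<close> are triples; the three
  facts compare their entries.\<close>

lemma braid:
  assumes "x \<in> X" "y \<in> X" "z \<in> X"
  shows braid_upper: "g (g x y) (g (f y x) z) = g x (g y z)"
    and braid_middle: "f (g (f y x) z) (g x y) = g (f (g y z) x) (f z y)"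
    and braid_lower: "f z (f y x) = f (f z y) (f (g y z) x)"
proof -
  have "\<forall>w \<in> X \<times> X \<times> X. on_12 \<sigma> (on_23 \<sigma> (on_12 \<sigma> w)) = on_23 \<sigma> (on_12 \<sigma> (on_23 \<sigma> w))"
    using birack unfolding birack_def by (elim conjE)
  moreover have "(x, y, z) \<in> X \<times> X \<times> X" using assms by simp
  ultimately have "on_12 \<sigma> (on_23 \<sigma> (on_12 \<sigma> (x, y, z))) = on_23 \<sigma> (on_12 \<sigma> (on_23 \<sigma> (x, y, z)))"
    by (rule bspec)
  then have "(g (g x y) (g (f y x) z), f (g (f y x) z) (g x y), f z (f y x)) =
      (g x (g y z), g (f (g y z) x) (f z y), f (f z y) (f (g y z) x))"
    by (simp only: on_12_def on_23_def birack_eq prod.case fst_conv snd_conv)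
  then show "g (g x y) (g (f y x) z) = g x (g y z)"
    "f (g (f y x) z) (g x y) = g (f (g y z) x) (f z y)"
    "f z (f y x) = f (f z y) (f (g y z) x)"
    by (simp_all only: prod.inject)
qed

section \<open>Squares and their actions\<close>

text \<open>The hypothesis identifies \<open>z\<close> as the preimage of \<open>x\<close> under
  \<open>g x\<close>, the inverse value that occurs in \<open>derived_rack\<close>. Computing a
  square thus reduces to exhibiting such a \<open>z\<close>.\<close>

lemma square_eq:
  assumes "x \<in> X" "z \<in> X" "g x z = x"
  shows "sq x = g x (f z x)"
proof -
  have "inv_into X (g x) x = z"
    using bij_betw_inv_into_left[OF bij_upper[OF assms(1)] assms(2)] assms(3) by simp
  then show ?thesis by (simp add: derived_rack_def)
qed

text \<open>In \<open>braid_upper\<close> at \<open>(x, z, u)\<close> the equation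
  \<open>g x z = x\<close> makes the outer map on both sides the injective map
  \<open>g x\<close>.\<close>

lemma fixed_upper:
  assumes "x \<in> X" "z \<in> X" "g x z = x" "u \<in> X"
  shows "g (f z x) u = g z u"
  by (rule upper_cancel[of x]) (use braid_upper[of x z u] assms in auto)

lemma fixed_lower:
  assumes "x \<in> X" "z \<in> X" "g x z = x" "u \<in> X"
  shows "f (f z x) u = f z u"
proof -
  \<comment> \<open>Writing \<open>u\<close> as \<open>f x p\<close> makes
    \<open>braid_lower\<close> at \<open>(p, x, z)\<close> applicable: with
    \<open>g x z = x\<close>, the inner term on both sides becomes \<open>f x p\<close>.\<close>
  obtain p where "p \<in> X" "f x p = u" by (rule lower_surjE[OF assms(1,4)])
  then show ?thesis using braid_lower[of p x z] assms by simp
qed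

lemma squareE:
  assumes "x \<in> X"
  obtains z w where "z \<in> X" "w \<in> X" "g x z = x" "f z x = w" "g x w = sq x" "f w x = w"
proof -
  obtain z where z: "z \<in> X" "g x z = x" by (rule upper_surjE[OF assms assms])
  \<comment> \<open>The second equation is \<open>fixed_lower\<close> evaluated at \<open>x\<close>
    itself.\<close>
  have "g x (f z x) = sq x" "f (f z x) x = f z x"
    using square_eq[OF assms z] fixed_lower[OF assms z assms] by simp_all
  with z show thesis
    by (rule that[OF _ lower_closed[OF z(1) assms] _ refl])
qed

lemma square_closed [simp]:
  assumes "x \<in> X" shows "sq x \<in> X"
proof -
  obtain z where z: "z \<in> X" "g x z = x" by (rule upper_surjE[OF assms assms])
  then show ?thesis using square_eq[OF assms z] assms by simp
qed

text \<open>With \<open>w\<close> from \<open>squareE\<close>, \<open>braid_upper\<close> at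
  \<open>(x, w, p)\<close> compares \<open>g (sq x)\<close> and \<open>g x\<close> at the point
  \<open>g w p\<close>, and every \<open>u\<close> has this form.\<close>

lemma upper_square_left:
  assumes "x \<in> X" "u \<in> X"
  shows "g (sq x) u = g x u"
proof -
  obtain z w where w: "z \<in> X" "w \<in> X" "g x z = x" "f z x = w" "g x w = sq x"
    "f w x = w"
    using squareE[OF assms(1)] by blast
  obtain p where "p \<in> X" "g w p = u" by (rule upper_surjE[OF w(2) assms(2)])
  then show ?thesis using braid_upper[of x w p] assms w by simp
qed

text \<open>Here \<open>braid_lower\<close> at \<open>(u, x, w)\<close> has \<open>f w\<close>
  outermost on both sides, so injectivity takes the place of surjectivity.\<close>

lemma lower_square_left:
  assumes "x \<in> X" "u \<in> X"
  shows "f (sq x) u = f x u"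
proof -
  obtain z w where w: "z \<in> X" "w \<in> X" "g x z = x" "f z x = w" "g x w = sq x"
    "f w x = w"
    using squareE[OF assms(1)] by blast
  show ?thesis
    by (rule lower_cancel[of w]) (use braid_lower[of u x w] assms w in auto)
qed

text \<open>The braid equation transports the pair \<open>z\<close>, \<open>w\<close> belonging to
  \<open>y\<close> to the pair \<open>g (f y t) z\<close>, \<open>g (f y t) w\<close> belonging to
  \<open>g t y\<close>.\<close>

lemma upper_square_right:
  assumes "t \<in> X" "y \<in> X"
  shows "g t (sq y) = sq (g t y)"
proof -
  obtain z w where zw: "z \<in> X" "w \<in> X" "g y z = y" "f z y = w" "g y w = sq y"
    "f w y = w"
    using squareE[OF assms(2)] by blast
  let ?v = "f y t"
  have "g (g t y) (g ?v z) = g t y" "f (g ?v z) (g t y) = g ?v w"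
    using braid_upper[of t y z] braid_middle[of t y z] zw assms by simp_all
  then have "sq (g t y) = g (g t y) (g ?v w)"
    using square_eq[of "g t y" "g ?v z"] assms zw by simp
  also have "\<dots> = g t (sq y)"
    using braid_upper[of t y w] zw assms by simp
  finally show ?thesis by simp
qed

lemma lower_square_right:
  assumes "t \<in> X" "y \<in> X"
  shows "f t (sq y) = sq (f t y)"
proof -
  obtain z w where zw: "z \<in> X" "w \<in> X" "g y z = y" "f z y = w" "g y w = sq y"
    "f w y = w"
    using squareE[OF assms(2)] by blast
  \<comment> \<open>The point \<open>x\<close> is chosen so that \<open>f (g z x)\<close> is
    \<open>f t\<close>. Since \<open>z\<close> and \<open>w\<close> act equally,
    \<open>f (g w x)\<close> is \<open>f t\<close> as well, so the braid equation at
    \<open>(y, z, x)\<close> and at \<open>(y, w, x)\<close> speaks about the same map.\<close>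
  obtain x where x: "x \<in> X" "g z x = t" by (rule upper_surjE[OF zw(1) assms(1)])
  have gw: "g w x = t" using fixed_upper[OF assms(2) zw(1,3) x(1)] zw(4) x(2) by simp
  let ?q = "f t y"
  \<comment> \<open>The pair belonging to \<open>?q\<close> is \<open>f x z\<close>,
    \<open>f x w\<close>.\<close>
  have "g ?q (f x z) = ?q" "f (f x z) ?q = f x w"
    using braid_middle[of y z x] braid_lower[of y z x] gw zw x assms by simp_all
  then have "sq ?q = g ?q (f x w)"
    using square_eq[of ?q "f x z"] assms zw x by simp
  also have "\<dots> = f t (sq y)"
    using braid_middle[of y w x] gw zw x assms by simp
  finally show ?thesis by simp
qed

section \<open>Compatibility of the equivalence with the birack\<close>

lemma square_equiv_closed:
  assumes "(a, b) \<in> square_equiv X \<sigma>" shows "a \<in> X" "b \<in> X"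
  using assms by (auto simp: square_equiv_def gen_equiv_def)

lemma square_equiv_square: "x \<in> X \<Longrightarrow> (x, sq x) \<in> square_equiv X \<sigma>"
  unfolding square_equiv_def by (rule subsetD[OF gen_equiv_superset]) auto

lemma square_equiv_acts_equally:
  assumes "(a, b) \<in> square_equiv X \<sigma>" "u \<in> X"
  shows "g a u = g b u \<and> f a u = f b u"
  using assms(1)
proof (induction rule: square_equiv_induct)
  case (square x)
  then show ?case using assms(2) by (simp add: upper_square_left lower_square_left)
qed simp_all

lemma square_equiv_compatible:
  assumes "(a, b) \<in> square_equiv X \<sigma>" "t \<in> X"
  shows "(g t a, g t b) \<in> square_equiv X \<sigma> \<and> (f t a, f t b) \<in> square_equiv X \<sigma>"
  using assms(1)
proof (induction rule: square_equiv_induct)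
  case (refl x)
  then show ?case
    using assms(2) square_equiv_class_eq_iff upper_closed lower_closed by metis
next
  case (sym x y)
  then show ?case using equivE[OF equiv_square_equiv] symD by metis
next
  case (trans x y z)
  then show ?case using equivE[OF equiv_square_equiv] transD by metis
next
  case (square x)
  then show ?case
    using assms(2) square_equiv_square by (simp add: upper_square_right lower_square_right)
qed

text \<open>The image inside \<open>the_elem\<close> is a singleton: replacing the index of a
  component map by an equivalent element leaves the value unchanged, and replacing the argument
  moves the value only within its class.\<close>

lemma induced_map_class:
  assumes "x \<in> X" "y \<in> X"
  defines "R \<equiv> square_equiv X \<sigma>"
  shows "induced_map R \<sigma> (R `` {x}, R `` {y}) = (R `` {g x y}, R `` {f y x})"
proof -
  let ?h = "\<lambda>(x, y). (R `` {g x y}, R `` {f y x})"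
  have self: "x \<in> R `` {x}" "y \<in> R `` {y}"
    unfolding R_def by (intro equiv_class_self[OF equiv_square_equiv] assms(1,2))+
  have eq: "?h (a, b) = ?h (x, y)" if "a \<in> R `` {x}" "b \<in> R `` {y}" for a b
  proof -
    have r: "(x, a) \<in> R" "(y, b) \<in> R" using that by auto
    then have in_X: "a \<in> X" "b \<in> X" using square_equiv_closed R_def by auto
    have "g x b = g a b" "f y a = f b a"
      using square_equiv_acts_equally[of x a b] square_equiv_acts_equally[of y b a] r in_X R_def
      by auto
    moreover have "(g x y, g x b) \<in> R" "(f y x, f y a) \<in> R"
      using square_equiv_compatible[of y b x] square_equiv_compatible[of x a y] r assms(1,2) R_def
      by auto
    ultimately have "?h (x, y) = ?h (a, b)"
      using in_X assms(1,2) by (simp add: R_def square_equiv_class_eq_iff)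
    then show ?thesis by (rule sym)
  qed
  have "?h p = ?h (x, y)" if "p \<in> R `` {x} \<times> R `` {y}" for p
    using eq[of "fst p" "snd p"] that by (simp add: mem_Times_iff split_beta)
  moreover have "R `` {x} \<times> R `` {y} \<noteq> {}" using self by blast
  ultimately have "the_elem (?h ` (R `` {x} \<times> R `` {y})) = ?h (x, y)"
    by (intro the_elem_image_unique)
  then show ?thesis by (simp only: induced_map_def prod.case)
qed

end


subsection \<open>Universal property of the enveloping group\<close>

definition eval_word ::
  "('g, 'm) monoid_scheme \<Rightarrow> ('a \<Rightarrow> 'g) \<Rightarrow> ('a \<times> bool) list \<Rightarrow> 'g" where
  "eval_word G h w =
     foldr (\<lambda>(x, b) a. (if b then h x else inv\<^bsub>G\<^esub> h x) \<otimes>\<^bsub>G\<^esub> a) w \<one>\<^bsub>G\<^esub>"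

lemma eval_word_simps [simp]:
  "eval_word G h [] = \<one>\<^bsub>G\<^esub>"
  "eval_word G h ((x, b) # w) = (if b then h x else inv\<^bsub>G\<^esub> h x) \<otimes>\<^bsub>G\<^esub> eval_word G h w"
  by (simp_all add: eval_word_def)

context group
begin


lemma eval_word_closed:
  "h \<in> Y \<rightarrow> carrier G \<Longrightarrow> w \<in> free_words Y \<Longrightarrow> eval_word G h w \<in> carrier G"
  by (induction w) (auto simp: free_words_def Pi_iff)

lemma eval_word_append:
  "h \<in> Y \<rightarrow> carrier G \<Longrightarrow> u \<in> free_words Y \<Longrightarrow> v \<in> free_words Y \<Longrightarrow>
    eval_word G h (u @ v) = eval_word G h u \<otimes> eval_word G h v"
proof (induction u)
  case Nil
  then show ?case using eval_word_closed[of h Y v] by simp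
next
  case (Cons l u)
  obtain x b where "l = (x, b)" by (cases l)
  with Cons show ?case
    using eval_word_closed[of h Y u] eval_word_closed[of h Y v]
    by (auto simp: m_assoc free_words_def Pi_iff)
qed

text \<open>Having equal values is an equivalence relation on words and contains all elementary
  cancellations, hence it contains \<open>free_rel Y\<close>. This lets evaluation descend to
  classes.\<close>

lemma eval_word_free_rel:
  assumes h: "h \<in> Y \<rightarrow> carrier G" and ab: "(a, b) \<in> free_rel Y"
  shows "eval_word G h a = eval_word G h b"
proof -
  let ?R = "{(a, b). a \<in> free_words Y \<and> b \<in> free_words Y \<and> eval_word G h a = eval_word G h b}"
  have "equiv (free_words Y) ?R"
    by (intro equivI refl_onI symI transI) auto
  moreover have "free_cancel Y \<subseteq> ?R"
  proof
    fix p assume "p \<in> free_cancel Y"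
    then obtain u v x c where p: "p = (u @ [(x, c), (x, \<not> c)] @ v, u @ v)"
      "u \<in> free_words Y" "v \<in> free_words Y" "x \<in> Y"
      by (auto simp: free_cancel_def)
    have w: "[(x, c), (x, \<not> c)] @ v \<in> free_words Y" using p by (auto simp: free_words_def)
    have "h x \<in> carrier G" using h p by auto
    then have "eval_word G h ([(x, c), (x, \<not> c)] @ v) = eval_word G h v"
      using eval_word_closed[OF h p(3)] by (auto simp flip: m_assoc)
    then have "eval_word G h (u @ [(x, c), (x, \<not> c)] @ v) = eval_word G h (u @ v)"
      by (simp only: eval_word_append[OF h p(2) w] eval_word_append[OF h p(2,3)])
    then show "p \<in> ?R" using p w free_words_append by auto
  qed
  ultimately have "free_rel Y \<subseteq> ?R"
    unfolding free_rel_def by (rule gen_equiv_least)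
  with ab show ?thesis by auto
qed

end

lemma free_group_carrierE:
  assumes "A \<in> carrier (free_group Y)"
  obtains a where "a \<in> free_words Y" "A = free_rel Y `` {a}"
  using assms by (auto simp: free_group_def quotient_def)

lemma free_group_lift:
  assumes "group G" "h \<in> Y \<rightarrow> carrier G"
  obtains \<phi> where "\<phi> \<in> hom (free_group Y) G" "\<And>x. x \<in> Y \<Longrightarrow> \<phi> (free_gen Y x) = h x"
proof -
  interpret group G by fact
  \<comment> \<open>Evaluation is constant on each class, so \<open>the_elem\<close> extracts its
    common value there.\<close>
  define \<phi> where "\<phi> A = the_elem (eval_word G h ` A)" for A
  have eval: "\<phi> (free_rel Y `` {a}) = eval_word G h a" if "a \<in> free_words Y" for a
  proof -
    have "the_elem (eval_word G h ` (free_rel Y `` {a})) = eval_word G h a"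
    proof (rule the_elem_image_unique)
      show "free_rel Y `` {a} \<noteq> {}"
        using equiv_class_self[OF equiv_free_rel that] by blast
      show "eval_word G h b = eval_word G h a" if "b \<in> free_rel Y `` {a}" for b
        using that eval_word_free_rel[OF assms(2), of a b] by simp
    qed
    then show ?thesis by (simp add: \<phi>_def)
  qed
  show thesis
  proof
    show "\<phi> \<in> hom (free_group Y) G"
      using assms(2)
      by (auto intro!: homI elim!: free_group_carrierE
          simp: eval eval_word_closed eval_word_append free_group_mult free_words_append)
    fix x assume "x \<in> Y"
    then show "\<phi> (free_gen Y x) = h x"
      using assms(2) funcset_mem[OF assms(2)] by (simp add: free_gen_def eval free_words_def)
  qed
qed

lemma free_group_hom_eqI:
  assumes G: "group G" and \<phi>: "\<phi> \<in> hom (free_group Y) G" and \<psi>: "\<psi> \<in> hom (free_group Y) G"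
    and gen: "\<And>x. x \<in> Y \<Longrightarrow> \<phi> (free_gen Y x) = \<psi> (free_gen Y x)"
    and A: "A \<in> carrier (free_group Y)"
  shows "\<phi> A = \<psi> A"
proof -
  interpret F: group "free_group Y" by (rule group_free_group)
  interpret \<phi>: group_hom "free_group Y" G \<phi>
    using G \<phi> by (simp add: group_hom_def group_hom_axioms_def group_free_group)
  interpret \<psi>: group_hom "free_group Y" G \<psi>
    using G \<psi> by (simp add: group_hom_def group_hom_axioms_def group_free_group)
  have one: "free_rel Y `` {[]} = \<one>\<^bsub>free_group Y\<^esub>" by (simp add: free_group_def)
  \<comment> \<open>Agreement is assumed only on positive letters; recognising the class of a
    negative letter as a group inverse extends it to all letters.\<close>
  have letter: "free_rel Y `` {[(x, b)]} =
      (if b then free_gen Y x else inv\<^bsub>free_group Y\<^esub> free_gen Y x)" if "x \<in> Y" for x b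
  proof (cases b)
    case False
    have w: "[(x, False)] \<in> free_words Y" "[(x, True)] \<in> free_words Y"
      using that by (auto simp: free_words_def)
    have "free_rel Y `` {[(x, False)]} \<otimes>\<^bsub>free_group Y\<^esub> free_gen Y x = \<one>\<^bsub>free_group Y\<^esub>"
      using free_rel_inverse[OF w(2)] equiv_class_eq[OF equiv_free_rel]
      by (fastforce simp: free_gen_def free_group_mult[OF w] simp flip: one)
    moreover have "free_rel Y `` {[(x, False)]} \<in> carrier (free_group Y)"
      using w by (auto simp: free_group_def intro: quotientI)
    ultimately show ?thesis
      using False F.inv_equality free_gen_closed[OF that] by simp
  qed (simp add: free_gen_def)
  have "\<phi> (free_rel Y `` {a}) = \<psi> (free_rel Y `` {a})" if "a \<in> free_words Y" for a
    using that
  proof (induction a)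
    case Nil
    then show ?case by (simp add: one)
  next
    case (Cons l a)
    obtain x b where l: "l = (x, b)" by (cases l)
    have x: "x \<in> Y" and a: "a \<in> free_words Y" and w: "[(x, b)] \<in> free_words Y"
      using Cons.prems l by (auto simp: free_words_def)
    have "free_rel Y `` {l # a} = free_rel Y `` {[(x, b)]} \<otimes>\<^bsub>free_group Y\<^esub> free_rel Y `` {a}"
      using free_group_mult[OF w a] l by simp
    moreover have "free_rel Y `` {[(x, b)]} \<in> carrier (free_group Y)"
      "free_rel Y `` {a} \<in> carrier (free_group Y)"
      using w a by (auto simp: free_group_def intro: quotientI)
    moreover have "\<phi> (free_rel Y `` {[(x, b)]}) = \<psi> (free_rel Y `` {[(x, b)]})"
      using gen[OF x] free_gen_closed[OF x] by (simp add: letter[OF x])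
    ultimately show ?case using Cons.IH[OF a] by simp
  qed
  then show ?thesis using A by (metis free_group_carrierE)
qed

section \<open>Passage to the quotient by the relators\<close>

context
  fixes Y :: "'a set" and \<tau> :: "'a \<times> 'a \<Rightarrow> 'a \<times> 'a"
  assumes closed: "\<tau> ` (Y \<times> Y) \<subseteq> Y \<times> Y"
begin

lemma map_closedD: "x \<in> Y \<Longrightarrow> y \<in> Y \<Longrightarrow> \<tau> (x, y) = (z, t) \<Longrightarrow> z \<in> Y \<and> t \<in> Y"
  using closed by (metis SigmaI image_subset_iff mem_Sigma_iff)

lemma enveloping_relators_closed: "enveloping_relators Y \<tau> \<subseteq> carrier (free_group Y)"
proof -
  interpret group "free_group Y" by (rule group_free_group)
  show ?thesis
    unfolding enveloping_relators_def
    by (auto intro!: m_closed inv_closed free_gen_closed dest: map_closedD)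
qed

lemma normal_enveloping_kernel: "enveloping_kernel Y \<tau> \<lhd> free_group Y"
  unfolding enveloping_kernel_def
  by (rule normal_normal_closure[OF group_free_group enveloping_relators_closed])

lemma enveloping_projection_hom:
  "(\<lambda>A. enveloping_kernel Y \<tau> #>\<^bsub>free_group Y\<^esub> A) \<in> hom (free_group Y) (enveloping_group Y \<tau>)"
  unfolding enveloping_group_def by (rule normal.r_coset_hom_Mod[OF normal_enveloping_kernel])

lemma enveloping_carrierE:
  assumes "B \<in> carrier (enveloping_group Y \<tau>)"
  obtains A where "A \<in> carrier (free_group Y)" "B = enveloping_kernel Y \<tau> #>\<^bsub>free_group Y\<^esub> A"
  using assms by (auto simp: enveloping_group_def FactGroup_def RCOSETS_def)

lemma enveloping_gen_closed: "x \<in> Y \<Longrightarrow> enveloping_gen Y \<tau> x \<in> carrier (enveloping_group Y \<tau>)"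
  unfolding enveloping_gen_def using enveloping_projection_hom
  by (auto dest: hom_in_carrier free_gen_closed)

text \<open>The quotient of the two sides in the free group is a relator, hence lies in the kernel,
  so both sides have the same coset.\<close>

lemma enveloping_gen_relation:
  assumes "x \<in> Y" "y \<in> Y" "\<tau> (x, y) = (z, t)"
  shows "enveloping_gen Y \<tau> x \<otimes>\<^bsub>enveloping_group Y \<tau>\<^esub> enveloping_gen Y \<tau> y
       = enveloping_gen Y \<tau> z \<otimes>\<^bsub>enveloping_group Y \<tau>\<^esub> enveloping_gen Y \<tau> t"
proof -
  interpret F: group "free_group Y" by (rule group_free_group)
  interpret N: normal "enveloping_kernel Y \<tau>" "free_group Y" by (rule normal_enveloping_kernel)
  let ?p = "\<lambda>A. enveloping_kernel Y \<tau> #>\<^bsub>free_group Y\<^esub> A"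
  let ?l = "free_gen Y x \<otimes>\<^bsub>free_group Y\<^esub> free_gen Y y"
  let ?r = "free_gen Y z \<otimes>\<^bsub>free_group Y\<^esub> free_gen Y t"
  have zt: "z \<in> Y" "t \<in> Y" using map_closedD[OF assms] by simp_all
  have lr: "?l \<in> carrier (free_group Y)" "?r \<in> carrier (free_group Y)"
    using assms zt by (simp_all add: free_gen_closed)
  have "?l \<otimes>\<^bsub>free_group Y\<^esub> inv\<^bsub>free_group Y\<^esub> ?r \<in> enveloping_relators Y \<tau>"
    unfolding enveloping_relators_def using assms by blast
  then have mem: "?l \<otimes>\<^bsub>free_group Y\<^esub> inv\<^bsub>free_group Y\<^esub> ?r \<in> enveloping_kernel Y \<tau>"
    by (auto simp: enveloping_kernel_def normal_closure_def)
  have "?p ?l = ?p ?r"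
    by (rule F.repr_independence[OF N.rcos_module_rev[OF F.is_group lr(2,1) mem] lr(2)
          N.subgroup_axioms, symmetric])
  then show ?thesis
    using hom_mult[OF enveloping_projection_hom] assms zt
    by (simp add: enveloping_gen_def free_gen_closed)
qed

text \<open>By \<open>rel\<close>, the lift of \<open>h\<close> to the free group kills every
  relator. Its kernel is normal, so it contains the normal closure, and the lift factors through the
  quotient.\<close>

lemma enveloping_lift:
  assumes "group G" "h \<in> Y \<rightarrow> carrier G"
    and rel: "\<And>x y z t. x \<in> Y \<Longrightarrow> y \<in> Y \<Longrightarrow> \<tau> (x, y) = (z, t) \<Longrightarrow>
      h x \<otimes>\<^bsub>G\<^esub> h y = h z \<otimes>\<^bsub>G\<^esub> h t"
  obtains \<phi> where "\<phi> \<in> hom (enveloping_group Y \<tau>) G"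
    "\<And>x. x \<in> Y \<Longrightarrow> \<phi> (enveloping_gen Y \<tau> x) = h x"
proof -
  obtain \<psi> where \<psi>: "\<psi> \<in> hom (free_group Y) G" "\<And>x. x \<in> Y \<Longrightarrow> \<psi> (free_gen Y x) = h x"
    using free_group_lift[OF assms(1,2)] by blast
  interpret \<psi>: group_hom "free_group Y" G \<psi>
    using assms(1) \<psi>(1) by (simp add: group_hom_def group_hom_axioms_def group_free_group)
  have "enveloping_relators Y \<tau> \<subseteq> kernel (free_group Y) G \<psi>"
  proof
    fix r assume r: "r \<in> enveloping_relators Y \<tau>"
    then obtain x y z t where xyzt: "x \<in> Y" "y \<in> Y" "\<tau> (x, y) = (z, t)"
      "r = free_gen Y x \<otimes>\<^bsub>free_group Y\<^esub> free_gen Y y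
         \<otimes>\<^bsub>free_group Y\<^esub> inv\<^bsub>free_group Y\<^esub> (free_gen Y z \<otimes>\<^bsub>free_group Y\<^esub> free_gen Y t)"
      unfolding enveloping_relators_def by blast
    moreover have "z \<in> Y" "t \<in> Y" using map_closedD[OF xyzt(1-3)] by simp_all
    moreover have "h z \<in> carrier G" "h t \<in> carrier G" using calculation assms(2) by auto
    ultimately have "\<psi> r = \<one>\<^bsub>G\<^esub>"
      using rel[OF xyzt(1-3)] by (simp add: free_gen_closed \<psi>(2))
    then show "r \<in> kernel (free_group Y) G \<psi>"
      using r enveloping_relators_closed by (auto simp: kernel_def)
  qed
  then have N: "enveloping_kernel Y \<tau> \<subseteq> kernel (free_group Y) G \<psi>"
    unfolding enveloping_kernel_def normal_closure_def using \<psi>.normal_kernel by blast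
  obtain \<phi> where \<phi>: "\<phi> \<in> hom (free_group Y Mod enveloping_kernel Y \<tau>) G"
    "\<And>A. A \<in> carrier (free_group Y) \<Longrightarrow> \<phi> (enveloping_kernel Y \<tau> #>\<^bsub>free_group Y\<^esub> A) = \<psi> A"
    using \<psi>.FactGroup_universal_kernel[OF normal_enveloping_kernel N] by metis
  show thesis
  proof
    show "\<phi> \<in> hom (enveloping_group Y \<tau>) G" using \<phi>(1) by (simp add: enveloping_group_def)
    show "\<phi> (enveloping_gen Y \<tau> x) = h x" if "x \<in> Y" for x
      using that by (simp add: enveloping_gen_def \<phi>(2) \<psi>(2) free_gen_closed)
  qed
qed

text \<open>Composing with the coset projection, which is onto, reduces the claim to homomorphisms
  out of the free group.\<close>

lemma enveloping_hom_eqI: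
  assumes "group G" "\<phi> \<in> hom (enveloping_group Y \<tau>) G" "\<psi> \<in> hom (enveloping_group Y \<tau>) G"
    and "\<And>x. x \<in> Y \<Longrightarrow> \<phi> (enveloping_gen Y \<tau> x) = \<psi> (enveloping_gen Y \<tau> x)"
    and "B \<in> carrier (enveloping_group Y \<tau>)"
  shows "\<phi> B = \<psi> B"
proof -
  let ?p = "\<lambda>A. enveloping_kernel Y \<tau> #>\<^bsub>free_group Y\<^esub> A"
  obtain A where A: "A \<in> carrier (free_group Y)" "B = ?p A"
    using assms(5) by (rule enveloping_carrierE)
  note proj = enveloping_projection_hom
  have "(\<phi> \<circ> ?p) A = (\<psi> \<circ> ?p) A"
    by (rule free_group_hom_eqI[OF assms(1) hom_compose[OF proj assms(2)]
          hom_compose[OF proj assms(3)] _ A(1)])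
      (simp add: assms(4) flip: enveloping_gen_def)
  with A show ?thesis by simp
qed

end

text \<open>Each composite agrees with the identity on generators, hence everywhere by
  \<open>enveloping_hom_eqI\<close>.\<close>

lemma enveloping_group_isoI:
  assumes Y: "\<tau> ` (Y \<times> Y) \<subseteq> Y \<times> Y" and Z: "\<rho> ` (Z \<times> Z) \<subseteq> Z \<times> Z"
    and \<phi>: "\<phi> \<in> hom (enveloping_group Y \<tau>) (enveloping_group Z \<rho>)"
    and \<psi>: "\<psi> \<in> hom (enveloping_group Z \<rho>) (enveloping_group Y \<tau>)"
    and \<psi>\<phi>: "\<And>x. x \<in> Y \<Longrightarrow> \<psi> (\<phi> (enveloping_gen Y \<tau> x)) = enveloping_gen Y \<tau> x"
    and \<phi>\<psi>: "\<And>x. x \<in> Z \<Longrightarrow> \<phi> (\<psi> (enveloping_gen Z \<rho> x)) = enveloping_gen Z \<rho> x"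
  shows "\<phi> \<in> iso (enveloping_group Y \<tau>) (enveloping_group Z \<rho>)"
proof -
  let ?G = "enveloping_group Y \<tau>" and ?H = "enveloping_group Z \<rho>"
  have id: "(\<lambda>x. x) \<in> hom ?G ?G" "(\<lambda>x. x) \<in> hom ?H ?H" by (auto intro!: homI)
  have "(\<psi> \<circ> \<phi>) a = a" if "a \<in> carrier ?G" for a
    by (rule enveloping_hom_eqI[OF Y group_enveloping_group[OF Y] hom_compose[OF \<phi> \<psi>] id(1) _ that])
      (simp add: \<psi>\<phi>)
  moreover have "(\<phi> \<circ> \<psi>) b = b" if "b \<in> carrier ?H" for b
    by (rule enveloping_hom_eqI[OF Z group_enveloping_group[OF Z] hom_compose[OF \<psi> \<phi>] id(2) _ that])
      (simp add: \<phi>\<psi>)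
  ultimately have "bij_betw \<phi> (carrier ?G) (carrier ?H)"
    using \<phi> \<psi> by (intro bij_betw_byWitness[of _ \<psi>]) (auto dest: hom_in_carrier)
  with \<phi> show ?thesis by (simp add: iso_def)
qed


subsection \<open>Identification of the enveloping groups\<close>

lemma birack_closed: "birack X \<sigma> \<Longrightarrow> \<sigma> ` (X \<times> X) \<subseteq> X \<times> X"
  by (simp add: birack_def bij_betw_def)

lemma enveloping_gen_square:
  assumes "birack X \<sigma>" "x \<in> X"
  shows "enveloping_gen X \<sigma> (derived_rack X \<sigma> x x) = enveloping_gen X \<sigma> x"
proof -
  note closed = birack_closed[OF assms(1)]
  interpret group "enveloping_group X \<sigma>" by (rule group_enveloping_group[OF closed])
  obtain w where w: "w \<in> X" "upper_map \<sigma> x w = derived_rack X \<sigma> x x" "lower_map \<sigma> w x = w"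
    using squareE[OF assms] by blast
  then have "\<sigma> (x, w) = (derived_rack X \<sigma> x x, w)"
    by (simp add: birack_eq[OF assms(1)])
  \<comment> \<open>Both products in this relation end in the generator of \<open>w\<close>, which
    is cancelled.\<close>
  from enveloping_gen_relation[OF closed assms(2) w(1) this] show ?thesis
    using assms w square_closed by (simp add: enveloping_gen_closed[OF closed])
qed

lemma enveloping_gen_square_equiv:
  assumes "birack X \<sigma>" "(x, y) \<in> square_equiv X \<sigma>"
  shows "enveloping_gen X \<sigma> x = enveloping_gen X \<sigma> y"
  using assms(2)
  by (induction rule: square_equiv_induct)
    (simp_all add: square_closed[OF assms(1)] enveloping_gen_square[OF assms(1)])

theorem proposition4p1:
  fixes X :: "'a set" and \<sigma> :: "'a \<times> 'a \<Rightarrow> 'a \<times> 'a"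
  assumes "finite X" and "birack X \<sigma>"
  shows "\<exists>\<phi> \<in> iso (enveloping_group X \<sigma>)
                 (enveloping_group (X // square_equiv X \<sigma>) (induced_map (square_equiv X \<sigma>) \<sigma>)).
           \<forall>x \<in> X. \<phi> (enveloping_gen X \<sigma> x) =
             enveloping_gen (X // square_equiv X \<sigma>) (induced_map (square_equiv X \<sigma>) \<sigma>)
               (square_equiv X \<sigma> `` {x})"
proof -
  let ?R = "square_equiv X \<sigma>"
  let ?Z = "X // ?R" and ?\<rho> = "induced_map ?R \<sigma>"
  let ?G = "enveloping_group X \<sigma>" and ?H = "enveloping_group ?Z ?\<rho>"
  let ?a = "enveloping_gen X \<sigma>" and ?b = "enveloping_gen ?Z ?\<rho>"
  note birack = assms(2)
  note X = birack_closed[OF birack]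
  note ind = induced_map_class[OF birack]
  have cls: "?R `` {x} \<in> ?Z" if "x \<in> X" for x
    using that by (rule quotientI)
  have Z: "?\<rho> ` (?Z \<times> ?Z) \<subseteq> ?Z \<times> ?Z"
    by (auto elim!: quotientE simp: ind upper_closed[OF birack] lower_closed[OF birack] cls)
  obtain \<phi> where \<phi>: "\<phi> \<in> hom ?G ?H" "\<And>x. x \<in> X \<Longrightarrow> \<phi> (?a x) = ?b (?R `` {x})"
  proof (rule enveloping_lift[OF X group_enveloping_group[OF Z], of "\<lambda>x. ?b (?R `` {x})"])
    show "(\<lambda>x. ?b (?R `` {x})) \<in> X \<rightarrow> carrier ?H"
      using enveloping_gen_closed[OF Z] cls by auto
    fix x y z t assume "x \<in> X" "y \<in> X" "\<sigma> (x, y) = (z, t)"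
    then show "?b (?R `` {x}) \<otimes>\<^bsub>?H\<^esub> ?b (?R `` {y}) = ?b (?R `` {z}) \<otimes>\<^bsub>?H\<^esub> ?b (?R `` {t})"
      \<comment> \<open>The pair of classes of \<open>x\<close> and \<open>y\<close> is sent by
        \<open>?\<rho>\<close> to the classes of \<open>z\<close> and \<open>t\<close>, so the
        required equation is a defining relation of \<open>?H\<close>.\<close>
      by (intro enveloping_gen_relation[OF Z] cls) (simp_all add: ind birack_eq[OF birack])
  qed blast
  \<comment> \<open>An arbitrary representative suffices: equivalent elements of \<open>X\<close>
    have the same generator in \<open>?G\<close>, so \<open>?a (rep A)\<close> does not depend on
    the choice.\<close>
  define rep where "rep A = (SOME x. x \<in> A)" for A :: "'a set"
  have rep: "?a (rep (?R `` {x})) = ?a x" if "x \<in> X" for x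
  proof -
    have "x \<in> ?R `` {x}" using that equiv_class_self[OF equiv_square_equiv] by metis
    then have "(x, rep (?R `` {x})) \<in> ?R" unfolding rep_def by (metis Image_singleton_iff someI)
    then show ?thesis using enveloping_gen_square_equiv[OF birack] by metis
  qed
  obtain \<psi> where \<psi>: "\<psi> \<in> hom ?H ?G" "\<And>A. A \<in> ?Z \<Longrightarrow> \<psi> (?b A) = ?a (rep A)"
  proof (rule enveloping_lift[OF Z group_enveloping_group[OF X], of "\<lambda>A. ?a (rep A)"])
    show "(\<lambda>A. ?a (rep A)) \<in> ?Z \<rightarrow> carrier ?G"
      using enveloping_gen_closed[OF X] by (auto elim!: quotientE simp: rep)
    fix A B C D assume AB: "A \<in> ?Z" "B \<in> ?Z" "?\<rho> (A, B) = (C, D)"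
    then obtain x y where xy: "x \<in> X" "y \<in> X" "A = ?R `` {x}" "B = ?R `` {y}"
      by (auto elim!: quotientE)
    then have CD: "C = ?R `` {upper_map \<sigma> x y}" "D = ?R `` {lower_map \<sigma> y x}"
      using AB ind by auto
    \<comment> \<open>After each chosen representative is replaced by \<open>x\<close>,
      \<open>y\<close> or a component of \<open>\<sigma> (x, y)\<close>, this is the defining
      relation of \<open>?G\<close> at \<open>(x, y)\<close>.\<close>
    show "?a (rep A) \<otimes>\<^bsub>?G\<^esub> ?a (rep B) = ?a (rep C) \<otimes>\<^bsub>?G\<^esub> ?a (rep D)"
      using enveloping_gen_relation[OF X xy(1,2) birack_eq[OF birack]] xy CD
      by (simp add: rep upper_closed[OF birack] lower_closed[OF birack])
  qed blast
  have "\<phi> \<in> iso ?G ?H"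
  proof (rule enveloping_group_isoI[OF X Z \<phi>(1) \<psi>(1)])
    fix x assume "x \<in> X"
    then show "\<psi> (\<phi> (?a x)) = ?a x" by (simp add: \<phi>(2) \<psi>(2) cls rep)
  next
    fix A assume "A \<in> ?Z"
    then show "\<phi> (\<psi> (?b A)) = ?b A"
      by (auto elim!: quotientE simp: \<phi>(2) \<psi>(2) cls rep)
  qed
  then show ?thesis using \<phi>(2) by blast
qed

end
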